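(* Let $(\theta_1,\dots,\theta_n)\in\mathbb C^n$ and let $f$ be the rational function $$f(z)=\frac{n(-1)^n\theta_n^pz^{n-1}+(n-1)(-1)^{n-1}\theta_{n-1}z^{n-2}+\cdots+(-\theta_1)}{n-(n-1)\theta_1z+\cdots+(-1)^{n-1}\theta_{n-1}z^{n-1}}.$$ Then the following are equivalent: (1) $(\theta_1,\dots,\theta_n)\in\mathbf{\Theta}_n$. (2) $(\theta_1,\dots,\theta_{n-1},\theta_n^p)\in G_n$. (3) $\sup_{|z|\le1}|f(z)|<1$. (4) $|\theta_n|<1$ and there exists $(\alpha_1,\dots,\alpha_{n-1})\in G_{n-1}$ such that $\theta_i=\alpha_i+\overline{\alpha}_{n-i}\theta_n^p$ for $1\le i\le n-1$.
   Context: $\mathbb D$ is the open unit disc. Fix positive integers $m,p$ with $p$ dividing $m$, and $n\ge2$. Let $s_i$ denote the $i$-th elementary symmetric polynomial; for $d\ge1$, $G_d=\{(s_1(z),\dots,s_d(z)):z\in\mathbb D^d\}$ is the open symmetrized polydisc. The domain $\mathbf{\Theta}_n$ is the image of $\mathbb D^n$ under the map $z\mapsto\big(s_1(z_1^m,\dots,z_n^m),\dots,s_{n-1}(z_1^m,\dots,z_n^m),(z_1\cdots z_n)^{m/p}\big)$. With $\theta_0=1$, the numerator of $f$ is $\sum_{i=1}^{n-1}(-1)^i i\theta_iz^{i-1}+(-1)^n n\theta_n^pz^{n-1}$ and its denominator is $\sum_{i=0}^{n-1}(-1)^i(n-i)\theta_iz^i$. As a rational function $f$ is understood after cancellation of common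 factors of numerator and denominator, with $|f|=\infty$ at poles. *)

theory Defs
  imports "HOL-Analysis.Analysis" "HOL-Computational_Algebra.Computational_Algebra"
    "HOL-Computational_Algebra.Field_as_Ring"
begin

text \<open>
  A point of \<open>\<complex>\<^sup>d\<close> is a function in \<open>{1..d} \<rightarrow>\<^sub>E UNIV\<close>: coordinates are numbered from 1 and the
  function is \<open>undefined\<close> off \<open>{1..d}\<close>, so that equality of points is equality of coordinates.
\<close>

definition elem_sym :: "nat \<Rightarrow> nat \<Rightarrow> (nat \<Rightarrow> complex) \<Rightarrow> complex" where
  "elem_sym d i z = (\<Sum>J | J \<subseteq> {1..d} \<and> card J = i. \<Prod>j\<in>J. z j)"

definition polydisc :: "nat \<Rightarrow> (nat \<Rightarrow> complex) set" where
  "polydisc d = {1..d} \<rightarrow>\<^sub>E ball 0 1"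

definition symmetrized_polydisc :: "nat \<Rightarrow> (nat \<Rightarrow> complex) set" where
  "symmetrized_polydisc d = (\<lambda>z. \<lambda>i\<in>{1..d}. elem_sym d i z) ` polydisc d"

definition Theta_map :: "nat \<Rightarrow> nat \<Rightarrow> nat \<Rightarrow> (nat \<Rightarrow> complex) \<Rightarrow> (nat \<Rightarrow> complex)" where
  "Theta_map m p n z =
     (\<lambda>i\<in>{1..n}. if i < n then elem_sym n i (\<lambda>j. z j ^ m) else (\<Prod>j\<in>{1..n}. z j) ^ (m div p))"

definition Theta_domain :: "nat \<Rightarrow> nat \<Rightarrow> nat \<Rightarrow> (nat \<Rightarrow> complex) set" where
  "Theta_domain m p n = Theta_map m p n ` polydisc n"

definition f_numerator :: "nat \<Rightarrow> nat \<Rightarrow> (nat \<Rightarrow> complex) \<Rightarrow> complex poly" where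
  "f_numerator p n \<theta> =
     (\<Sum>i\<in>{1..n-1}. monom ((-1) ^ i * of_nat i * \<theta> i) (i - 1))
       + monom ((-1) ^ n * of_nat n * \<theta> n ^ p) (n - 1)"

text \<open>The convention \<open>\<theta>\<^sub>0 = 1\<close> is made explicit, as \<open>\<theta>\<close> has no coordinate 0.\<close>

definition f_denominator :: "nat \<Rightarrow> (nat \<Rightarrow> complex) \<Rightarrow> complex poly" where
  "f_denominator n \<theta> =
     (\<Sum>i\<in>{0..n-1}. monom ((-1) ^ i * of_nat (n - i) * (if i = 0 then 1 else \<theta> i)) i)"

definition f_rational :: "nat \<Rightarrow> nat \<Rightarrow> (nat \<Rightarrow> complex) \<Rightarrow> complex poly fract" where
  "f_rational p n \<theta> = Fract (f_numerator p n \<theta>) (f_denominator n \<theta>)"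

text \<open>
  Modulus of a rational function at a point. \<^const>\<open>quot_of_fract\<close> yields the numerator and
  denominator in lowest terms, so the zeros of the denominator are exactly the poles.
\<close>

definition rat_fun_abs :: "complex poly fract \<Rightarrow> complex \<Rightarrow> ereal" where
  "rat_fun_abs r z =
     (case quot_of_fract r of (a, b) \<Rightarrow>
        if poly b z = 0 then \<infinity> else ereal (cmod (poly a z / poly b z)))"

end

theory Submission
  imports Defs "HOL-Complex_Analysis.Conformal_Mappings"
begin

text \<open>
  Write \<open>q = \<theta>\<^sub>n\<^sup>p\<close> and \<open>P(z) = 1 - \<theta>\<^sub>1 z + \<dots> + (-1)\<^sup>n q z\<^sup>n\<close>. A point of the symmetrized polydisc is
  the same thing as a factorization \<open>P(z) = (1 - w\<^sub>1 z) \<dots> (1 - w\<^sub>n z)\<close> with all \<open>w\<^sub>j\<close> in the open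
  disc, hence the same thing as the absence of zeros of \<open>P\<close> in the closed disc
  (\<open>symmetrized_polydisc_iff_no_zeros\<close>). Each of the other three conditions is compared with this one.

  \<^item> For \<open>\<Theta>\<^sub>n\<close>, one extracts \<open>m\<close>-th roots \<open>y\<^sub>j\<close> of the \<open>w\<^sub>j\<close>. Then \<open>(y\<^sub>1 \<dots> y\<^sub>n)\<close> to the power \<open>m/p\<close> is a
    \<open>p\<close>-th root of \<open>q\<close>, and it becomes the prescribed root \<open>\<theta>\<^sub>n\<close> when \<open>y\<^sub>1\<close> is multiplied by a suitable
    \<open>m\<close>-th root of unity (\<open>Theta_domain_iff\<close>).

  \<^item> The function \<open>f\<close> is \<open>P' / (n P - z P')\<close>. If all \<open>w\<^sub>j\<close> lie in the disc, put
    \<open>U(z) = \<Sum>\<^sub>j 1 / (1 - w\<^sub>j z)\<close>; then \<open>z P' = P (n - U)\<close> and \<open>n P - z P' = P U\<close>. Since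
    \<open>x \<mapsto> 1 / (1 - x)\<close> maps the unit disc into the half plane \<open>Re > 1/2\<close>, one has \<open>Re U > n/2\<close>,
    that is \<open>|n - U| < |U|\<close>. So \<open>|f| < 1\<close> on the circle, and the maximum principle gives a bound below 1
    on the disc. Conversely, let \<open>f = a/b\<close> in lowest terms. Then \<open>n a P = P' (b + z a)\<close>, and
    \<open>|a| < |b|\<close> forbids zeros of \<open>b + z a\<close> in the closed disc; a zero of \<open>P\<close> there would be a zero
    of \<open>P'\<close> of at least the same order, which is absurd (\<open>no_zeros_iff_sup_less_1\<close>).

  \<^item> The last condition is a Schur reduction step. Let \<open>P\<^sup>*(z)\<close> be the polynomial with the conjugate
    coefficients in reverse order. When \<open>P\<close> has no zeros in the closed disc, \<open>P\<^sup>*/P\<close> is a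
    finite Blaschke product, so \<open>|P\<^sup>*| \<le> |P|\<close> there. The polynomial \<open>Q\<close> with coordinates \<open>\<alpha>\<close> satisfies
    \<open>(1 - |q|\<^sup>2) Q = P - (-1)\<^sup>n q P\<^sup>*\<close> and \<open>P = Q + (-1)\<^sup>n q z Q\<^sup>*\<close>, and in both formulas the first summand
    dominates because \<open>|q| < 1\<close>. Hence one of \<open>P\<close> and \<open>Q\<close> has no zeros in the closed disc if and only if
    the other has none (\<open>symmetrized_polydisc_reduction\<close>).
\<close>

section \<open>Coordinates of the symmetrized polydisc as coefficients\<close>

text \<open>
  The coordinate with index 0 is replaced by 1, so that the constant term is 1 whatever \<open>s 0\<close> is.
\<close>

definition vieta_poly :: "nat \<Rightarrow> (nat \<Rightarrow> complex) \<Rightarrow> complex poly" where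
  "vieta_poly d s = (\<Sum>i\<le>d. monom ((-1) ^ i * (if i = 0 then 1 else s i)) i)"

lemma coeff_vieta_poly:
  "coeff (vieta_poly d s) i = (if i \<le> d then (-1) ^ i * (if i = 0 then 1 else s i) else 0)"
proof -
  have "coeff (vieta_poly d s) i
      = (\<Sum>k\<le>d. if k = i then (-1) ^ k * (if k = 0 then 1 else s k) else 0)"
    by (simp add: vieta_poly_def coeff_sum)
  then show ?thesis by (simp only: sum.delta finite_atMost atMost_iff)
qed

lemma poly_vieta_poly_0 [simp]: "poly (vieta_poly d s) 0 = 1"
  by (simp add: poly_0_coeff_0 coeff_vieta_poly)

lemma degree_vieta_poly: "degree (vieta_poly d s) \<le> d"
  by (rule degree_le) (simp add: coeff_vieta_poly)

lemma coeff_prod_linear_factors: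
  fixes w :: "'a \<Rightarrow> complex"
  assumes "finite A"
  shows "coeff (\<Prod>j\<in>A. [:1, - w j:]) i = (-1) ^ i * (\<Sum>J | J \<subseteq> A \<and> card J = i. \<Prod>j\<in>J. w j)"
proof -
  have "(\<Prod>j\<in>A. [:1, - w j:]) = (\<Prod>j\<in>A. 1 - monom (w j) 1)"
    by (intro prod.cong refl) (simp add: monom_altdef one_pCons)
  also have "\<dots> = (\<Sum>X\<in>Pow A. (-1) ^ card X * (\<Prod>x\<in>X. monom (w x) 1))"
    by (simp add: prod_diff_conv_sum[OF assms])
  also have "\<dots> = (\<Sum>X\<in>Pow A. monom ((-1) ^ card X * (\<Prod>x\<in>X. w x)) (card X))"
  proof (intro sum.cong refl)
    fix X assume "X \<in> Pow A"
    then have "finite X" using assms finite_subset by auto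
    then have "(\<Prod>x\<in>X. monom (w x) 1) = monom (\<Prod>x\<in>X. w x) (card X)"
      by induction (simp_all add: mult_monom)
    moreover have "(-1) ^ k * q = smult ((-1) ^ k) q" for k and q :: "complex poly"
      by (cases "even k") simp_all
    ultimately show "(-1) ^ card X * (\<Prod>x\<in>X. monom (w x) 1)
        = monom ((-1) ^ card X * (\<Prod>x\<in>X. w x)) (card X)"
      by (simp add: smult_monom)
  qed
  finally have "coeff (\<Prod>j\<in>A. [:1, - w j:]) i
      = (\<Sum>X\<in>Pow A. if card X = i then (-1) ^ card X * (\<Prod>x\<in>X. w x) else 0)"
    by (simp add: coeff_sum)
  also have "\<dots> = (\<Sum>X | X \<subseteq> A \<and> card X = i. (-1) ^ i * (\<Prod>x\<in>X. w x))"
    using assms by (intro sum.mono_neutral_cong_right) auto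
  finally show ?thesis by (simp add: sum_distrib_left)
qed

lemma elem_sym_0 [simp]: "elem_sym d 0 z = 1"
proof -
  have "J = {}" if "J \<subseteq> {1..d}" "card J = 0" for J
    using finite_subset[OF that(1)] that(2) by simp
  then have "{J. J \<subseteq> {1..d} \<and> card J = 0} = {{}}" by (intro equalityI subsetI) auto
  then show ?thesis unfolding elem_sym_def by simp
qed

lemma elem_sym_top: "elem_sym d d z = (\<Prod>j\<in>{1..d}. z j)"
proof -
  have "J = {1..d}" if "J \<subseteq> {1..d}" "card J = d" for J
    using card_subset_eq[OF _ that(1)] that(2) by simp
  then have "{J. J \<subseteq> {1..d} \<and> card J = d} = {{1..d}}" by (intro equalityI subsetI) auto
  then show ?thesis unfolding elem_sym_def by simp
qed

lemma elem_sym_cong: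
  assumes "\<And>j. j \<in> {1..d} \<Longrightarrow> z j = w j"
  shows "elem_sym d i z = elem_sym d i w"
  unfolding elem_sym_def using assms by (intro sum.cong prod.cong refl) blast

text \<open>
  Vieta's formulas. Factors \<open>1 - w\<^sub>j z\<close> are used rather than \<open>z - w\<^sub>j\<close>: a parameter \<open>w\<^sub>j = 0\<close> then only
  lowers the degree, and the degree \<open>d\<close> enters as an upper bound.
\<close>

lemma vieta_poly_eq_prod_iff:
  "vieta_poly d s = (\<Prod>j\<in>{1..d}. [:1, - w j:]) \<longleftrightarrow> (\<forall>i\<in>{1..d}. s i = elem_sym d i w)"
proof -
  have prod: "coeff (\<Prod>j\<in>{1..d}. [:1, - w j:]) i = (-1) ^ i * elem_sym d i w" for i
    by (simp add: coeff_prod_linear_factors elem_sym_def)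
  have big: "elem_sym d i w = 0" if "d < i" for i
  proof -
    have "card J \<noteq> i" if "J \<subseteq> {1..d}" for J
      using card_mono[OF _ that] \<open>d < i\<close> by auto
    then have "{J. J \<subseteq> {1..d} \<and> card J = i} = {}" by blast
    then show ?thesis unfolding elem_sym_def by (simp only: sum.empty)
  qed
  show ?thesis
  proof
    assume eq: "vieta_poly d s = (\<Prod>j\<in>{1..d}. [:1, - w j:])"
    show "\<forall>i\<in>{1..d}. s i = elem_sym d i w"
    proof
      fix i assume "i \<in> {1..d}"
      then show "s i = elem_sym d i w"
        using arg_cong[OF eq, of "\<lambda>P. coeff P i"] unfolding prod coeff_vieta_poly by simp
    qed
  next
    assume s: "\<forall>i\<in>{1..d}. s i = elem_sym d i w"
    show "vieta_poly d s = (\<Prod>j\<in>{1..d}. [:1, - w j:])"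
    proof (rule poly_eqI)
      fix i
      consider "i = 0" | "i \<in> {1..d}" | "d < i" by fastforce
      then show "coeff (vieta_poly d s) i = coeff (\<Prod>j\<in>{1..d}. [:1, - w j:]) i"
        unfolding prod coeff_vieta_poly using s big by cases auto
    qed
  qed
qed

text \<open>
  The fundamental theorem of algebra, with the missing factors for \<open>degree P < d\<close> supplied by
  \<open>w\<^sub>j = 0\<close>.
\<close>

lemma split_into_linear_factors:
  fixes P :: "complex poly"
  assumes "degree P \<le> d" and "poly P 0 = 1"
  shows "\<exists>w. P = (\<Prod>j\<in>{1..d}. [:1, - w j:])"
  using assms
proof (induction d arbitrary: P)
  case 0
  then obtain c where "P = [:c:]" using degree_eq_zeroE[of P] by auto
  with 0 have "P = 1" by (simp add: one_pCons)
  then show ?case by simp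
next
  case (Suc d)
  have "\<exists>c Q. P = [:1, - c:] * Q \<and> degree Q \<le> d"
  proof (cases "degree P = 0")
    case True
    then show ?thesis by (intro exI[of _ 0] exI[of _ P]) simp
  next
    case False
    then have "\<not> constant (poly P)" by (simp add: constant_degree)
    then obtain r where r: "poly P r = 0" using Fundamental_Theorem_Algebra.fundamental_theorem_of_algebra[of P] by auto
    with Suc.prems(2) have "r \<noteq> 0" by (cases "r = 0") simp_all
    from r obtain Q where Q: "P = [:- r, 1:] * Q"
      unfolding poly_eq_0_iff_dvd dvd_def by blast
    have "Q \<noteq> 0"
    proof
      assume "Q = 0"
      with Q False show False by simp
    qed
    then have "degree P = Suc (degree Q)"
      unfolding Q by (subst degree_mult_eq) simp_all
    moreover have "P = [:1, - (1 / r):] * smult (- r) Q"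
    proof -
      have "[:1, - (1 / r):] * smult (- r) Q = smult (- r) [:1, - (1 / r):] * Q"
        by (simp only: mult_smult_left mult_smult_right)
      also have "smult (- r) [:1, - (1 / r):] = [:- r, 1:]" using \<open>r \<noteq> 0\<close> by simp
      finally show ?thesis using Q by simp
    qed
    moreover have "degree (smult (- r) Q) \<le> degree Q" by (rule degree_smult_le)
    ultimately show ?thesis using Suc.prems(1)
      by (intro exI[of _ "1 / r"] exI[of _ "smult (- r) Q"] conjI) simp_all
  qed
  then obtain c Q where Q: "P = [:1, - c:] * Q" "degree Q \<le> d" by blast
  moreover have "poly Q 0 = 1" using Suc.prems(2) Q(1) by simp
  ultimately obtain w where w: "Q = (\<Prod>j\<in>{1..d}. [:1, - w j:])" using Suc.IH by blast
  have "(\<Prod>j\<in>{1..d}. [:1, - (w(Suc d := c)) j:]) = Q"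
    unfolding w by (intro prod.cong) auto
  then have "P = (\<Prod>j\<in>{1..Suc d}. [:1, - (w(Suc d := c)) j:])"
    unfolding Q(1) by (simp only: prod.nat_ivl_Suc' fun_upd_same)
  then show ?case by blast
qed

lemma symmetrized_polydisc_iff_factors:
  assumes "s \<in> {1..d} \<rightarrow>\<^sub>E UNIV"
  shows "s \<in> symmetrized_polydisc d \<longleftrightarrow>
    (\<exists>w\<in>polydisc d. vieta_poly d s = (\<Prod>j\<in>{1..d}. [:1, - w j:]))"
proof -
  have "s = (\<lambda>i\<in>{1..d}. elem_sym d i w) \<longleftrightarrow> (\<forall>i\<in>{1..d}. s i = elem_sym d i w)" for w
    using assms by (auto simp: fun_eq_iff PiE_def extensional_def)
  then show ?thesis
    unfolding symmetrized_polydisc_def vieta_poly_eq_prod_iff by (simp add: image_iff)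
qed

text \<open>
  The zeros are the reciprocals of the nonzero \<open>w\<^sub>j\<close>, and inversion exchanges the open disc with the
  complement of the closed one.
\<close>

lemma no_zeros_in_disc_iff:
  fixes w :: "'a \<Rightarrow> complex"
  assumes "finite A"
  shows "(\<forall>z\<in>cball 0 1. poly (\<Prod>j\<in>A. [:1, - w j:]) z \<noteq> 0) \<longleftrightarrow> (\<forall>j\<in>A. cmod (w j) < 1)"
proof safe
  fix j assume nz: "\<forall>z\<in>cball 0 1. poly (\<Prod>j\<in>A. [:1, - w j:]) z \<noteq> 0" and j: "j \<in> A"
  show "cmod (w j) < 1"
  proof (rule ccontr)
    assume "\<not> cmod (w j) < 1"
    then have "w j \<noteq> 0" "1 / w j \<in> cball 0 1" by (auto simp: norm_divide divide_simps)
    then have "poly (\<Prod>j\<in>A. [:1, - w j:]) (1 / w j) = 0"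
      using assms j by (auto simp: poly_prod intro!: bexI[of _ j])
    with nz \<open>1 / w j \<in> cball 0 1\<close> show False by blast
  qed
next
  fix z :: complex
  assume w: "\<forall>j\<in>A. cmod (w j) < 1" and z: "z \<in> cball 0 1"
    and zero: "poly (\<Prod>j\<in>A. [:1, - w j:]) z = 0"
  then obtain j where j: "j \<in> A" "z * w j = 1"
    using assms by (auto simp: poly_prod)
  have "cmod z * cmod (w j) \<le> 1 * cmod (w j)"
    using z by (intro mult_right_mono) auto
  then show False using w j by (metis mult_1 norm_mult norm_one not_le)
qed

lemma symmetrized_polydisc_iff_no_zeros:
  assumes "s \<in> {1..d} \<rightarrow>\<^sub>E UNIV"
  shows "s \<in> symmetrized_polydisc d \<longleftrightarrow> (\<forall>z\<in>cball 0 1. poly (vieta_poly d s) z \<noteq> 0)"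
proof
  assume "s \<in> symmetrized_polydisc d"
  then obtain w where "w \<in> polydisc d" "vieta_poly d s = (\<Prod>j\<in>{1..d}. [:1, - w j:])"
    using symmetrized_polydisc_iff_factors[OF assms] by blast
  then show "\<forall>z\<in>cball 0 1. poly (vieta_poly d s) z \<noteq> 0"
    using no_zeros_in_disc_iff[of "{1..d}" w] by (auto simp: polydisc_def PiE_def Pi_def)
next
  assume nz: "\<forall>z\<in>cball 0 1. poly (vieta_poly d s) z \<noteq> 0"
  obtain w where w: "vieta_poly d s = (\<Prod>j\<in>{1..d}. [:1, - w j:])"
    using split_into_linear_factors[OF degree_vieta_poly poly_vieta_poly_0] by blast
  then have "restrict w {1..d} \<in> polydisc d"
    using nz no_zeros_in_disc_iff[of "{1..d}" w] by (auto simp: polydisc_def)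
  moreover have "vieta_poly d s = (\<Prod>j\<in>{1..d}. [:1, - restrict w {1..d} j:])"
    unfolding w by (intro prod.cong) auto
  ultimately show "s \<in> symmetrized_polydisc d"
    using symmetrized_polydisc_iff_factors[OF assms] by blast
qed

section \<open>Extraction of roots\<close>

lemma Theta_map_eq_iff:
  assumes "\<theta> \<in> {1..n} \<rightarrow>\<^sub>E UNIV" and "1 \<le> n"
  shows "\<theta> = Theta_map m p n z \<longleftrightarrow>
    (\<forall>i\<in>{1..n-1}. \<theta> i = elem_sym n i (\<lambda>j. z j ^ m)) \<and> \<theta> n = (\<Prod>j\<in>{1..n}. z j) ^ (m div p)"
proof -
  have ext: "\<theta> = restrict g {1..n} \<longleftrightarrow> (\<forall>i\<in>{1..n}. \<theta> i = g i)" for g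
    using assms(1) by (auto simp: fun_eq_iff PiE_def extensional_def)
  have "{1..n} = insert n {1..n-1}" using assms(2) by auto
  then show ?thesis using assms(2) unfolding Theta_map_def ext by auto
qed

text \<open>
  Only the last coordinate is at issue: it carries the choice of one \<open>p\<close>-th root of \<open>w\<^sub>1 \<dots> w\<^sub>n\<close>, and
  every choice is reached by an appropriate choice of the \<open>m\<close>-th roots of the \<open>w\<^sub>j\<close>.
\<close>

lemma Theta_domain_iff:
  assumes "0 < m" and "0 < p" and "p dvd m" and n: "1 \<le> n"
    and \<theta>: "\<theta> \<in> {1..n} \<rightarrow>\<^sub>E UNIV"
  shows "\<theta> \<in> Theta_domain m p n \<longleftrightarrow> \<theta>(n := \<theta> n ^ p) \<in> symmetrized_polydisc n"
proof -
  let ?s = "\<theta>(n := \<theta> n ^ p)"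
  define k where "k = m div p"
  have m: "m = k * p" and k: "0 < k"
    using assms by (auto simp: k_def dvd_div_eq_0_iff elim!: dvdE)
  have s: "?s \<in> {1..n} \<rightarrow>\<^sub>E UNIV" using \<theta> n by (auto simp: PiE_def extensional_def)
  have s_iff: "?s = (\<lambda>i\<in>{1..n}. elem_sym n i w) \<longleftrightarrow>
      (\<forall>i\<in>{1..n-1}. \<theta> i = elem_sym n i w) \<and> \<theta> n ^ p = (\<Prod>j\<in>{1..n}. w j)" for w
  proof -
    have "?s = (\<lambda>i\<in>{1..n}. elem_sym n i w) \<longleftrightarrow> (\<forall>i\<in>{1..n}. ?s i = elem_sym n i w)"
      using s by (auto simp: fun_eq_iff PiE_def extensional_def)
    moreover have "{1..n} = insert n {1..n-1}" using n by auto
    ultimately show ?thesis using n by (auto simp: elem_sym_top)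
  qed
  show ?thesis
  proof
    assume "\<theta> \<in> Theta_domain m p n"
    then obtain z where z: "z \<in> polydisc n" "\<theta> = Theta_map m p n z"
      by (auto simp: Theta_domain_def)
    then have z\<theta>: "\<forall>i\<in>{1..n-1}. \<theta> i = elem_sym n i (\<lambda>j. z j ^ m)"
        "\<theta> n = (\<Prod>j\<in>{1..n}. z j) ^ k"
      using Theta_map_eq_iff[OF \<theta> n, of m p z] unfolding k_def by blast+
    let ?w = "\<lambda>j\<in>{1..n}. z j ^ m"
    have "elem_sym n i (\<lambda>j. z j ^ m) = elem_sym n i ?w" for i
      by (rule elem_sym_cong) simp
    moreover have "\<theta> n ^ p = (\<Prod>j\<in>{1..n}. ?w j)"
    proof -
      have "\<theta> n ^ p = (\<Prod>j\<in>{1..n}. z j ^ m)"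
        by (simp only: z\<theta>(2) prod_power_distrib m power_mult)
      then show ?thesis by simp
    qed
    ultimately have "?s = (\<lambda>i\<in>{1..n}. elem_sym n i ?w)"
      using z\<theta>(1) unfolding s_iff by simp
    moreover have "?w \<in> polydisc n"
      using z(1) \<open>0 < m\<close> by (auto simp: polydisc_def norm_power power_less_one_iff)
    ultimately show "?s \<in> symmetrized_polydisc n"
      unfolding symmetrized_polydisc_def by blast
  next
    assume "?s \<in> symmetrized_polydisc n"
    then obtain w where w: "w \<in> polydisc n" "?s = (\<lambda>i\<in>{1..n}. elem_sym n i w)"
      unfolding symmetrized_polydisc_def by blast
    have "\<forall>j. \<exists>y. y ^ m = w j"
      using \<open>0 < m\<close> exists_complex_root by (metis less_numeral_extra(3))
    then obtain y where y: "\<And>j. y j ^ m = w j" by metis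
    define t where "t = (\<Prod>j\<in>{1..n}. y j) ^ k"
    have tp: "t ^ p = \<theta> n ^ p"
    proof -
      have "t ^ p = (\<Prod>j\<in>{1..n}. y j ^ m)"
        by (simp only: t_def prod_power_distrib m power_mult)
      then show ?thesis using w(2) unfolding s_iff y by simp
    qed
    \<comment> \<open>The quotient of two \<open>p\<close>-th roots of the same number is a \<open>p\<close>-th root of unity, so a \<open>k\<close>-th
      root of this quotient is an \<open>m\<close>-th root of unity.\<close>
    have "\<exists>\<zeta>. \<zeta> ^ k * t = \<theta> n \<and> \<zeta> ^ m = 1"
    proof (cases "t = 0")
      case True
      then have "\<theta> n ^ p = 0" using tp[symmetric] \<open>0 < p\<close> by (simp add: zero_power)
      then show ?thesis using True by (intro exI[of _ 1]) simp
    next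
      case False
      obtain \<zeta> where \<zeta>: "\<zeta> ^ k = \<theta> n / t"
        using k exists_complex_root by (metis less_numeral_extra(3))
      have "\<zeta> ^ m = \<theta> n ^ p / t ^ p" by (simp only: m power_mult \<zeta> power_divide)
      also have "\<dots> = 1" unfolding tp[symmetric] using False by simp
      finally show ?thesis using \<zeta> False by (intro exI[of _ \<zeta>]) simp
    qed
    then obtain \<zeta> where \<zeta>: "\<zeta> ^ k * t = \<theta> n" "\<zeta> ^ m = 1" by blast
    \<comment> \<open>Correcting a single coordinate by \<open>\<zeta>\<close> changes the product and leaves all \<open>m\<close>-th powers alone.\<close>
    define z where "z = (\<lambda>j\<in>{1..n}. if j = 1 then \<zeta> * y j else y j)"
    have zm: "z j ^ m = w j" if "j \<in> {1..n}" for j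
      using that \<zeta>(2) y by (simp add: z_def power_mult_distrib)
    have "elem_sym n i (\<lambda>j. z j ^ m) = elem_sym n i w" for i
      by (rule elem_sym_cong) (rule zm)
    moreover have "(\<Prod>j\<in>{1..n}. z j) = \<zeta> * (\<Prod>j\<in>{1..n}. y j)"
    proof -
      have "(\<Prod>j\<in>{1..n}. z j) = (\<Prod>j\<in>{1..n}. (if j = 1 then \<zeta> else 1) * y j)"
        by (intro prod.cong) (auto simp: z_def)
      also have "\<dots> = \<zeta> * (\<Prod>j\<in>{1..n}. y j)" using n by (simp add: prod.distrib prod.delta)
      finally show ?thesis .
    qed
    ultimately have "\<theta> = Theta_map m p n z"
      using w(2) \<zeta>(1) unfolding Theta_map_eq_iff[OF \<theta> n] s_iff t_def k_def[symmetric]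
      by (simp add: power_mult_distrib)
    moreover have "z \<in> polydisc n"
    proof -
      have "cmod (z j) < 1" if "j \<in> {1..n}" for j
      proof -
        have "cmod (z j) ^ m < 1"
          using zm[OF that] w(1) that by (auto simp: polydisc_def simp flip: norm_power)
        then show ?thesis using \<open>0 < m\<close> by (simp add: power_less_one_iff)
      qed
      then show ?thesis by (auto simp: polydisc_def z_def)
    qed
    ultimately show "\<theta> \<in> Theta_domain m p n" by (auto simp: Theta_domain_def)
  qed
qed

section \<open>The rational function\<close>

lemma quot_of_fract_Fract:
  fixes N D :: "complex poly"
  assumes "D \<noteq> 0" and "quot_of_fract (Fract N D) = (a, b)"
  shows "a * D = N * b" "coprime a b"
proof -
  have "Fract a b = Fract N D" "b \<noteq> 0"
    using Fract_quot_of_fract[of "Fract N D"] snd_quot_of_fract_nonzero[of "Fract N D"] assms(2)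
    by auto
  then show "a * D = N * b" using assms(1) by (simp add: eq_fract)
  show "coprime a b" using coprime_quot_of_fract[of "Fract N D"] assms(2) by simp
qed

text \<open>
  Where a given denominator does not vanish, passing to lowest terms has no effect, because the
  reduced denominator divides the given one.
\<close>

lemma rat_fun_abs_Fract:
  fixes N D :: "complex poly"
  assumes "poly D z \<noteq> 0"
  shows "rat_fun_abs (Fract N D) z = ereal (cmod (poly N z / poly D z))"
proof -
  obtain a b where ab: "quot_of_fract (Fract N D) = (a, b)" by fastforce
  have "D \<noteq> 0" using assms by auto
  note q = quot_of_fract_Fract[OF this ab]
  have "b dvd a * D" using q(1) by simp
  then have "b dvd D" using q(2) by (metis coprime_commute coprime_dvd_mult_right_iff)
  then have b: "poly b z \<noteq> 0" using assms by (metis dvdE mult_zero_left poly_mult)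
  have "poly a z * poly D z = poly N z * poly b z" using q(1) by (metis poly_mult)
  then have "poly a z / poly b z = poly N z / poly D z" using b assms by (simp add: field_simps)
  then show ?thesis by (simp add: rat_fun_abs_def ab b)
qed

lemma pderiv_sum: "pderiv (sum f A) = (\<Sum>a\<in>A. pderiv (f a))"
  by (induction A rule: infinite_finite_induct) (simp_all add: pderiv_add)

lemma f_numerator_eq:
  assumes "1 \<le> n"
  shows "f_numerator p n \<theta> = pderiv (vieta_poly n (\<theta>(n := \<theta> n ^ p)))"
proof -
  let ?s = "\<theta>(n := \<theta> n ^ p)"
  have "{..n} = insert 0 (insert n {1..n-1})" using assms by auto
  then have "pderiv (vieta_poly n ?s) = (\<Sum>i\<in>insert 0 (insert n {1..n-1}).
      monom (of_nat i * ((-1) ^ i * (if i = 0 then 1 else ?s i))) (i - 1))"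
    by (simp only: vieta_poly_def pderiv_sum pderiv_monom)
  also have "\<dots> = monom (of_nat n * ((-1) ^ n * \<theta> n ^ p)) (n - 1)
      + (\<Sum>i\<in>{1..n-1}. monom (of_nat i * ((-1) ^ i * (if i = 0 then 1 else ?s i))) (i - 1))"
    using assms by (subst sum.insert; simp)+
  also have "\<dots> = f_numerator p n \<theta>"
    unfolding f_numerator_def using assms
    by (subst add.commute) (intro arg_cong2[of _ _ _ _ "(+)"] sum.cong refl; auto simp: mult_ac)
  finally show ?thesis ..
qed

lemma f_denominator_eq:
  fixes \<theta> :: "nat \<Rightarrow> complex" and c :: complex
  assumes "1 \<le> n"
  defines "P \<equiv> vieta_poly n (\<theta>(n := c))"
  shows "f_denominator n \<theta> = smult (of_nat n) P - pCons 0 (pderiv P)"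
proof (rule poly_eqI)
  fix i
  have "coeff (f_denominator n \<theta>) i = (\<Sum>k\<in>{0..n-1}.
      if k = i then (-1) ^ k * of_nat (n - k) * (if k = 0 then 1 else \<theta> k) else 0)"
    by (simp add: f_denominator_def coeff_sum)
  also have "\<dots> = (if i \<le> n - 1 then (-1) ^ i * of_nat (n - i) * (if i = 0 then 1 else \<theta> i) else 0)"
    by (simp only: sum.delta finite_atLeastAtMost atLeastAtMost_iff) simp
  also have "\<dots> = coeff (smult (of_nat n) P - pCons 0 (pderiv P)) i"
    using assms(1)
    by (cases i) (auto simp: P_def coeff_vieta_poly coeff_pderiv of_nat_diff algebra_simps)
  finally show "coeff (f_denominator n \<theta>) i = coeff (smult (of_nat n) P - pCons 0 (pderiv P)) i" .
qed

text \<open>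
  Multiplied by \<open>2 |1 - x|\<^sup>2\<close>, the inequality reads \<open>1 - 2 Re x + |x|\<^sup>2 < 2 - 2 Re x\<close>.
\<close>

lemma Re_inverse_one_minus_gt_half:
  assumes "cmod x < 1"
  shows "1 / 2 < Re (1 / (1 - x))"
proof -
  have "(Re x)\<^sup>2 + (Im x)\<^sup>2 < 1"
    using assms by (metis cmod_power2 norm_ge_zero power2_eq_square power_one
        abs_square_less_1 abs_norm_cancel)
  moreover have "1 - x \<noteq> 0" using assms by auto
  then have "0 < (cmod (1 - x))\<^sup>2" by simp
  then have "0 < (1 - Re x)\<^sup>2 + (Im x)\<^sup>2" by (simp add: cmod_power2)
  ultimately show ?thesis
    by (simp add: Re_divide field_simps power2_eq_square)
qed

text \<open>
  The logarithmic derivative turns both polynomials into multiples of \<open>P\<close>: with \<open>U\<close> the sum of the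
  \<open>1 / (1 - z w\<^sub>j)\<close>, they are \<open>z P' = P (n - U)\<close> and \<open>D = P U\<close>. The inequality \<open>Re U > n/2\<close>
  places \<open>U\<close> closer to \<open>n\<close> than to 0.
\<close>

lemma pderiv_vs_polar_derivative:
  fixes n :: nat and w :: "nat \<Rightarrow> complex"
  defines "P \<equiv> (\<Prod>j\<in>{1..n}. [:1, - w j:])"
  defines "D \<equiv> smult (of_nat n) P - pCons 0 (pderiv P)"
  assumes n: "1 \<le> n" and w: "\<And>j. j \<in> {1..n} \<Longrightarrow> cmod (w j) < 1" and z: "cmod z \<le> 1"
  shows "poly D z \<noteq> 0" and "cmod z = 1 \<Longrightarrow> cmod (poly (pderiv P) z) < cmod (poly D z)"
proof -
  define U where "U = (\<Sum>j\<in>{1..n}. 1 / (1 - z * w j))"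
  have zw: "cmod (z * w j) < 1" if "j \<in> {1..n}" for j
    using mult_right_mono[OF z, of "cmod (w j)"] w[OF that] by (simp add: norm_mult)
  then have nz: "1 - z * w j \<noteq> 0" if "j \<in> {1..n}" for j using that by fastforce
  have P0: "poly P z \<noteq> 0" using nz by (auto simp: P_def poly_prod)
  have "poly (pderiv P) z = (\<Sum>j\<in>{1..n}. poly P z * (- w j / (1 - z * w j)))"
  proof -
    have "poly (pderiv P) z = (\<Sum>j\<in>{1..n}. (\<Prod>i\<in>{1..n}-{j}. 1 - z * w i) * (- w j))"
      by (simp add: P_def pderiv_prod poly_sum poly_prod pderiv_pCons mult.commute)
    also have "\<dots> = (\<Sum>j\<in>{1..n}. poly P z * (- w j / (1 - z * w j)))"
    proof (intro sum.cong refl)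
      fix j assume j: "j \<in> {1..n}"
      have "poly P z = (1 - z * w j) * (\<Prod>i\<in>{1..n}-{j}. 1 - z * w i)"
        using j by (simp add: P_def poly_prod prod.remove[of _ j] algebra_simps)
      then show "(\<Prod>i\<in>{1..n}-{j}. 1 - z * w i) * (- w j) = poly P z * (- w j / (1 - z * w j))"
        using nz[OF j] by simp
    qed
    finally show ?thesis .
  qed
  then have "z * poly (pderiv P) z = poly P z * (\<Sum>j\<in>{1..n}. z * (- w j / (1 - z * w j)))"
    by (simp add: sum_distrib_left mult_ac)
  also have "(\<Sum>j\<in>{1..n}. z * (- w j / (1 - z * w j))) = (\<Sum>j\<in>{1..n}. 1 - 1 / (1 - z * w j))"
    using nz by (intro sum.cong refl) (simp add: field_simps)
  also have "\<dots> = of_nat n - U" by (simp add: U_def sum_subtractf)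
  finally have zP': "z * poly (pderiv P) z = poly P z * (of_nat n - U)" .
  then have D: "poly D z = poly P z * U" by (simp add: D_def algebra_simps)
  have "real n / 2 = (\<Sum>j\<in>{1..n}. 1 / 2)" by simp
  also have "\<dots> < (\<Sum>j\<in>{1..n}. Re (1 / (1 - z * w j)))"
    using n by (intro sum_strict_mono Re_inverse_one_minus_gt_half zw) simp_all
  also have "\<dots> = Re U" by (simp add: U_def)
  finally have U: "real n / 2 < Re U" .
  then have "U \<noteq> 0" using n by auto
  with D P0 show "poly D z \<noteq> 0" by simp
  have "(cmod (of_nat n - U))\<^sup>2 < (cmod U)\<^sup>2"
  proof -
    have "real n * (real n - 2 * Re U) < 0" using n U by (intro mult_pos_neg) auto
    then show ?thesis by (simp add: cmod_power2) (simp add: power2_eq_square algebra_simps)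
  qed
  then have "cmod (of_nat n - U) < cmod U" by (rule power2_less_imp_less) simp
  then have "cmod (z * poly (pderiv P) z) < cmod (poly D z)"
    unfolding zP' D using P0 by (simp add: norm_mult)
  then show "cmod (poly (pderiv P) z) < cmod (poly D z)" if "cmod z = 1"
    using that by (simp add: norm_mult)
qed

text \<open>
  Compactness of the circle provides a uniform bound below 1 there, and the maximum principle carries
  it into the disc.
\<close>

lemma poly_quotient_bounded_on_disc:
  fixes N D :: "complex poly"
  assumes D: "\<And>z. cmod z \<le> 1 \<Longrightarrow> poly D z \<noteq> 0"
    and N: "\<And>z. cmod z = 1 \<Longrightarrow> cmod (poly N z) < cmod (poly D z)"
  shows "\<exists>B<1. \<forall>z\<in>cball 0 1. cmod (poly N z / poly D z) \<le> B"
proof -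
  let ?f = "\<lambda>z. poly N z / poly D z"
  have cont: "continuous_on (cball 0 1) ?f" using D by (auto intro!: continuous_intros)
  have "\<exists>x\<in>sphere 0 1. \<forall>y\<in>sphere (0::complex) 1. cmod (?f y) \<le> cmod (?f x)"
  proof (rule continuous_attains_sup)
    show "sphere (0::complex) 1 \<noteq> {}"
      using norm_one[where 'a = complex] by (metis dist_0_norm empty_iff mem_sphere)
    show "continuous_on (sphere 0 1) (\<lambda>z. cmod (?f z))"
      by (intro continuous_on_norm continuous_on_subset[OF cont]) auto
  qed auto
  then obtain x where x: "cmod x = 1" "\<And>y. cmod y = 1 \<Longrightarrow> cmod (?f y) \<le> cmod (?f x)" by auto
  have "cmod (?f z) \<le> cmod (?f x)" if "z \<in> cball 0 1" for z
  proof (rule maximum_modulus_frontier[OF _ _ _ _ that])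
    show "?f holomorphic_on interior (cball 0 1)" using D by (auto intro!: holomorphic_intros)
    show "cmod (?f y) \<le> cmod (?f x)" if "y \<in> frontier (cball 0 1)" for y
      using that x(2) by simp
  qed (use cont in auto)
  moreover have "cmod (?f x) < 1"
    using N[OF x(1)] D[of x] x(1) by (simp add: norm_divide)
  ultimately show ?thesis by blast
qed

text \<open>
  One direction is the estimate on the circle. The other works with the fraction \<open>a/b\<close> in lowest terms,
  where only \<open>|a| < |b|\<close> is known: clearing denominators gives \<open>n a P = P' (b + z a)\<close>, and comparing
  orders of vanishing excludes a zero of \<open>P\<close>.
\<close>

lemma no_zeros_iff_sup_less_1:
  fixes P :: "complex poly" and n :: nat
  assumes n: "1 \<le> n" and deg: "degree P \<le> n" and P0: "poly P 0 = 1"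
  defines "D \<equiv> smult (of_nat n) P - pCons 0 (pderiv P)"
  shows "(\<forall>z\<in>cball 0 1. poly P z \<noteq> 0) \<longleftrightarrow> (SUP z\<in>cball 0 1. rat_fun_abs (Fract (pderiv P) D) z) < 1"
proof
  assume nz: "\<forall>z\<in>cball 0 1. poly P z \<noteq> 0"
  obtain w where w: "P = (\<Prod>j\<in>{1..n}. [:1, - w j:])"
    using split_into_linear_factors[OF deg P0] by blast
  have wlt: "cmod (w j) < 1" if "j \<in> {1..n}" for j
    using nz no_zeros_in_disc_iff[of "{1..n}" w] that by (simp add: w)
  have *: "poly D z \<noteq> 0" "cmod z = 1 \<Longrightarrow> cmod (poly (pderiv P) z) < cmod (poly D z)"
    if "cmod z \<le> 1" for z
    using pderiv_vs_polar_derivative[of n w z] n wlt that unfolding D_def w by blast+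
  obtain B where B: "B < 1" "\<And>z. z \<in> cball 0 1 \<Longrightarrow> cmod (poly (pderiv P) z / poly D z) \<le> B"
    using poly_quotient_bounded_on_disc[of D "pderiv P"] * by auto
  have "(SUP z\<in>cball 0 1. rat_fun_abs (Fract (pderiv P) D) z) \<le> ereal B"
    using B(2) *(1) by (intro SUP_least) (simp add: rat_fun_abs_Fract)
  also have "\<dots> < 1" using B(1) by simp
  finally show "(SUP z\<in>cball 0 1. rat_fun_abs (Fract (pderiv P) D) z) < 1" .
next
  assume sup: "(SUP z\<in>cball 0 1. rat_fun_abs (Fract (pderiv P) D) z) < 1"
  have "poly D 0 = of_nat n" by (simp add: D_def P0)
  then have "D \<noteq> 0" using n by auto
  obtain a b where ab: "quot_of_fract (Fract (pderiv P) D) = (a, b)" by fastforce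
  define C where "C = b + pCons 0 a"
  have "a * (smult (of_nat n) P - pCons 0 (pderiv P)) = pderiv P * b"
    using quot_of_fract_Fract(1)[OF \<open>D \<noteq> 0\<close> ab] by (simp add: D_def)
  then have eq: "smult (of_nat n) (a * P) = pderiv P * C"
    by (simp add: C_def algebra_simps)
  show "\<forall>z\<in>cball 0 1. poly P z \<noteq> 0"
  proof
    fix z :: complex assume z: "z \<in> cball 0 1"
    have "rat_fun_abs (Fract (pderiv P) D) z < 1"
      using sup SUP_upper[OF z] by (rule le_less_trans[rotated])
    then have b: "poly b z \<noteq> 0" and "cmod (poly a z / poly b z) < 1"
      by (auto simp: rat_fun_abs_def ab split: if_splits)
    then have lt: "cmod (poly a z) < cmod (poly b z)" by (simp add: norm_divide)
    have C: "poly C z \<noteq> 0"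
    proof
      assume "poly C z = 0"
      then have "poly b z = - (z * poly a z)" by (simp add: C_def eq_neg_iff_add_eq_0)
      then have "cmod (poly b z) = cmod z * cmod (poly a z)" by (simp add: norm_mult)
      also have "\<dots> \<le> cmod (poly a z)" using z mult_right_mono[of "cmod z" 1 "cmod (poly a z)"] by simp
      finally show False using lt by simp
    qed
    show "poly P z \<noteq> 0"
    proof
      assume Pz: "poly P z = 0"
      have "P \<noteq> 0" using P0 by auto
      have P': "pderiv P \<noteq> 0"
      proof
        assume "pderiv P = 0"
        then have "degree P = 0" by (simp add: pderiv_eq_0_iff)
        then obtain c where "P = [:c:]" by (rule degree_eq_zeroE)
        then show False using P0 Pz by simp
      qed
      have "C \<noteq> 0" using C by auto
      then have r0: "pderiv P * C \<noteq> 0" using P' by simp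
      then have "a * P \<noteq> 0" unfolding eq[symmetric] by auto
      have "order z P \<le> order z (a * P)"
        using order_mult[OF \<open>a * P \<noteq> 0\<close>, of z] by simp
      also have "\<dots> = order z (pderiv P * C)"
        unfolding eq[symmetric] using n by (simp add: order_smult)
      also have "\<dots> = order z (pderiv P)"
        using order_mult[OF r0, of z] C order_root[of C z] by simp
      finally show False using order_pderiv[OF \<open>P \<noteq> 0\<close> Pz] by simp
    qed
  qed
qed

section \<open>The conjugate reciprocal polynomial\<close>

text \<open>
  For \<open>z \<noteq> 0\<close> the value at \<open>z\<close> is \<open>z\<^sup>d\<close> times the conjugate of \<open>P (1 / cnj z)\<close>, provided that
  \<open>degree P \<le> d\<close>. The degree bound \<open>d\<close> is a parameter, as it fixes the power of \<open>z\<close>.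
\<close>

definition conj_reciprocal :: "nat \<Rightarrow> complex poly \<Rightarrow> complex poly" where
  "conj_reciprocal d P = (\<Sum>i\<le>d. monom (cnj (coeff P (d - i))) i)"

lemma coeff_conj_reciprocal:
  "coeff (conj_reciprocal d P) i = (if i \<le> d then cnj (coeff P (d - i)) else 0)"
proof -
  have "coeff (conj_reciprocal d P) i = (\<Sum>k\<le>d. if k = i then cnj (coeff P (d - k)) else 0)"
    by (simp add: conj_reciprocal_def coeff_sum)
  then show ?thesis by (simp only: sum.delta finite_atMost atMost_iff)
qed

lemma conj_reciprocal_mult_linear:
  assumes "degree P \<le> d"
  shows "conj_reciprocal (Suc d) ([:1, - w:] * P) = [:- cnj w, 1:] * conj_reciprocal d P"
proof (rule poly_eqI)
  fix i
  have top: "coeff P (Suc d) = 0" using assms by (simp add: coeff_eq_0)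
  consider "i = 0" | k where "i = Suc k" "k < d" | "i = Suc d" | "Suc d < i"
    by (metis less_antisym not_less_eq old.nat.exhaust)
  then show "coeff (conj_reciprocal (Suc d) ([:1, - w:] * P)) i
      = coeff ([:- cnj w, 1:] * conj_reciprocal d P) i"
  proof cases
    case 2
    then obtain e where "d = Suc (k + e)" using less_imp_Suc_add by blast
    with 2 show ?thesis by (simp add: coeff_conj_reciprocal)
  qed (use top in \<open>auto simp: coeff_conj_reciprocal coeff_pCons split: nat.splits\<close>)
qed

lemma conj_reciprocal_prod:
  "conj_reciprocal d (\<Prod>j\<in>{1..d}. [:1, - w j:]) = (\<Prod>j\<in>{1..d}. [:- cnj (w j), 1:])"
proof (induction d)
  case 0
  show ?case by (simp add: conj_reciprocal_def)
next
  case (Suc d)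
  have "degree (\<Prod>j\<in>{1..d}. [:1, - w j:]) \<le> (\<Sum>j\<in>{1..d}. degree [:1, - w j:])"
    by (rule degree_prod_sum_le[unfolded o_def]) simp
  also have "\<dots> \<le> (\<Sum>j\<in>{1..d}. 1)" by (intro sum_mono) simp
  finally have "degree (\<Prod>j\<in>{1..d}. [:1, - w j:]) \<le> d" by simp
  from conj_reciprocal_mult_linear[OF this, of "w (Suc d)"] show ?case
    by (simp only: prod.nat_ivl_Suc' Suc.IH)
qed

text \<open>
  A Blaschke factor is bounded by 1 on the closed disc, which follows from the identity
  \<open>|1 - z w|\<^sup>2 - |z - cnj w|\<^sup>2 = (1 - |z|\<^sup>2) (1 - |w|\<^sup>2)\<close>.
\<close>

lemma cmod_diff_cnj_le:
  assumes "cmod w \<le> 1" and "cmod z \<le> 1"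
  shows "cmod (z - cnj w) \<le> cmod (1 - z * w)"
proof (rule power2_le_imp_le)
  have "0 \<le> (1 - (cmod z)\<^sup>2) * (1 - (cmod w)\<^sup>2)"
    using assms by (intro mult_nonneg_nonneg) (simp_all add: abs_square_le_1)
  also have "\<dots> = (cmod (1 - z * w))\<^sup>2 - (cmod (z - cnj w))\<^sup>2"
    by (simp add: cmod_power2) (simp add: power2_eq_square algebra_simps)
  finally show "(cmod (z - cnj w))\<^sup>2 \<le> (cmod (1 - z * w))\<^sup>2" by simp
qed simp

text \<open>
  The quotient of the two polynomials is a finite Blaschke product, so the estimate holds factor by
  factor.
\<close>

lemma cmod_conj_reciprocal_le:
  assumes P: "degree P \<le> d" "poly P 0 = 1" "\<forall>z\<in>cball 0 1. poly P z \<noteq> 0" and z: "cmod z \<le> 1"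
  shows "cmod (poly (conj_reciprocal d P) z) \<le> cmod (poly P z)"
proof -
  obtain w where w: "P = (\<Prod>j\<in>{1..d}. [:1, - w j:])"
    using split_into_linear_factors[OF P(1,2)] by blast
  have wlt: "cmod (w j) < 1" if "j \<in> {1..d}" for j
    using P(3) no_zeros_in_disc_iff[of "{1..d}" w] that by (simp add: w)
  have "cmod (poly (conj_reciprocal d P) z) = (\<Prod>j\<in>{1..d}. cmod (z - cnj (w j)))"
    unfolding w conj_reciprocal_prod by (simp add: poly_prod prod_norm)
  also have "\<dots> \<le> (\<Prod>j\<in>{1..d}. cmod (1 - z * w j))"
    using wlt z by (intro prod_mono conjI cmod_diff_cnj_le) (auto simp: less_imp_le)
  also have "\<dots> = cmod (poly P z)" by (simp add: w poly_prod prod_norm)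
  finally show ?thesis .
qed

lemma symmetrized_polydisc_last_lt_1:
  assumes "s \<in> symmetrized_polydisc d" and "1 \<le> d"
  shows "cmod (s d) < 1"
proof -
  obtain w where w: "w \<in> polydisc d" "s = (\<lambda>i\<in>{1..d}. elem_sym d i w)"
    using assms(1) unfolding symmetrized_polydisc_def by blast
  then have wlt: "cmod (w j) < 1" if "j \<in> {1..d}" for j
    using that by (auto simp: polydisc_def)
  have "cmod (s d) = cmod (w d) * (\<Prod>j\<in>{1..d}-{d}. cmod (w j))"
    using assms(2) by (simp add: w(2) elem_sym_top flip: prod_norm)
      (subst prod.remove[of _ d], auto)
  also have "\<dots> \<le> cmod (w d) * 1"
    using wlt by (intro mult_left_mono prod_le_1) (auto simp: less_imp_le)
  finally show ?thesis using wlt[of d] assms(2) by simp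
qed

lemma minus_one_power_mult_diff:
  assumes "i \<le> n"
  shows "(-1) ^ n * (-1) ^ (n - i) = ((-1) ^ i :: complex)"
proof -
  obtain k where "n = i + k" using assms le_Suc_ex by blast
  then show ?thesis by (simp add: power_add mult.assoc flip: power_mult_distrib)
qed

text \<open>
  The equations for \<open>s\<close> are linear over the reals in \<open>\<alpha>\<close>. Combining the one for \<open>i\<close> with the
  conjugate of the one for \<open>n - i\<close> solves them:
  \<open>(1 - |s\<^sub>n|\<^sup>2) \<alpha>\<^sub>i = s\<^sub>i - s\<^sub>n cnj s\<^bsub>n-i\<^esub>\<close>. In terms of the polynomials \<open>P\<close> and \<open>Q\<close> of \<open>s\<close> and \<open>\<alpha>\<close>
  this solution and the equations are the two identities \<open>(1 - |s\<^sub>n|\<^sup>2) Q = P - (-1)\<^sup>n s\<^sub>n P\<^sup>*\<close> and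
  \<open>P = Q + (-1)\<^sup>n s\<^sub>n z Q\<^sup>*\<close>, where \<open>P\<^sup>*\<close> and \<open>Q\<^sup>*\<close> are the conjugate reciprocals for the
  degree bounds \<open>n\<close> and \<open>n - 1\<close>. Since \<open>|s\<^sub>n| < 1\<close>, and \<open>|P\<^sup>*| \<le> |P|\<close> and \<open>|Q\<^sup>*| \<le> |Q|\<close> on the closed disc when \<open>P\<close>,
  respectively \<open>Q\<close>, has no zeros there, the second summand is never large enough to cancel the first.
\<close>

lemma symmetrized_polydisc_reduction:
  assumes n: "1 \<le> n" and s: "s \<in> {1..n} \<rightarrow>\<^sub>E UNIV"
  shows "s \<in> symmetrized_polydisc n \<longleftrightarrow>
    cmod (s n) < 1 \<and> (\<exists>\<alpha>\<in>symmetrized_polydisc (n - 1).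
      \<forall>i\<in>{1..n-1}. s i = \<alpha> i + cnj (\<alpha> (n - i)) * s n)"
proof (intro iffI conjI)
  assume mem: "s \<in> symmetrized_polydisc n"
  show lt: "cmod (s n) < 1" by (rule symmetrized_polydisc_last_lt_1[OF mem n])
  define P where "P = vieta_poly n s"
  define c where "c = 1 - s n * cnj (s n)"
  have c: "c \<noteq> 0" and cnj_c: "cnj c = c"
  proof -
    have "(cmod (s n))\<^sup>2 \<noteq> 1" using lt abs_square_less_1[of "cmod (s n)"] by simp
    then show "c \<noteq> 0" unfolding c_def complex_norm_square[symmetric]
      by (metis eq_iff_diff_eq_0 of_real_eq_1_iff)
    show "cnj c = c" by (simp add: c_def mult.commute)
  qed
  define \<alpha> where "\<alpha> = (\<lambda>i\<in>{1..n-1}. (s i - s n * cnj (s (n - i))) / c)"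
  have Q: "smult c (vieta_poly (n - 1) \<alpha>) = P - smult ((-1) ^ n * s n) (conj_reciprocal n P)"
  proof (rule poly_eqI)
    fix i
    consider "i = 0" | "i \<in> {1..n-1}" | "i = n" "i \<noteq> 0" | "n < i" using n by fastforce
    then show "coeff (smult c (vieta_poly (n - 1) \<alpha>)) i
        = coeff (P - smult ((-1) ^ n * s n) (conj_reciprocal n P)) i"
    proof cases
      case 1
      then show ?thesis using n minus_one_power_mult_diff[of 0 n]
        by (simp add: P_def coeff_vieta_poly coeff_conj_reciprocal c_def)
    next
      case 2
      then have "coeff (P - smult ((-1) ^ n * s n) (conj_reciprocal n P)) i
          = (-1) ^ i * s i - ((-1) ^ n * (-1) ^ (n - i)) * (s n * cnj (s (n - i)))"
        by (auto simp: P_def coeff_vieta_poly coeff_conj_reciprocal)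
      also have "\<dots> = (-1) ^ i * (s i - s n * cnj (s (n - i)))"
        using 2 by (subst minus_one_power_mult_diff) (auto simp: algebra_simps)
      finally show ?thesis using 2 c by (auto simp: coeff_vieta_poly \<alpha>_def)
    qed (simp_all add: P_def coeff_vieta_poly coeff_conj_reciprocal)
  qed
  have \<alpha>: "\<alpha> \<in> {1..n-1} \<rightarrow>\<^sub>E UNIV" by (simp add: \<alpha>_def)
  have nz: "\<forall>z\<in>cball 0 1. poly P z \<noteq> 0"
    using mem symmetrized_polydisc_iff_no_zeros[OF s] by (simp add: P_def)
  have "\<forall>z\<in>cball 0 1. poly (vieta_poly (n - 1) \<alpha>) z \<noteq> 0"
  proof
    fix z :: complex assume z: "z \<in> cball 0 1"
    have "cmod (s n) * cmod (poly (conj_reciprocal n P) z) \<le> cmod (s n) * cmod (poly P z)"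
      using cmod_conj_reciprocal_le[of P n z] nz z
      by (intro mult_left_mono) (auto simp: P_def degree_vieta_poly)
    also have "\<dots> < cmod (poly P z)" using lt nz z by simp
    finally have "poly P z \<noteq> (-1) ^ n * s n * poly (conj_reciprocal n P) z"
      by (auto simp: norm_mult norm_power)
    then have "poly (smult c (vieta_poly (n - 1) \<alpha>)) z \<noteq> 0" unfolding Q by simp
    then show "poly (vieta_poly (n - 1) \<alpha>) z \<noteq> 0" by auto
  qed
  then have "\<alpha> \<in> symmetrized_polydisc (n - 1)"
    using symmetrized_polydisc_iff_no_zeros[OF \<alpha>] by simp
  moreover have "s i = \<alpha> i + cnj (\<alpha> (n - i)) * s n" if "i \<in> {1..n-1}" for i
  proof -
    have "n - i \<in> {1..n-1}" "n - (n - i) = i" using that by auto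
    then have "c * (\<alpha> i + cnj (\<alpha> (n - i)) * s n)
        = (s i - s n * cnj (s (n - i))) + (cnj (s (n - i)) - cnj (s n) * s i) * s n"
      using that c by (simp add: \<alpha>_def cnj_c distrib_left)
    also have "\<dots> = c * s i" by (simp add: c_def algebra_simps)
    finally show ?thesis using c by simp
  qed
  ultimately show "\<exists>\<alpha>\<in>symmetrized_polydisc (n - 1).
      \<forall>i\<in>{1..n-1}. s i = \<alpha> i + cnj (\<alpha> (n - i)) * s n" by blast
next
  assume "cmod (s n) < 1 \<and> (\<exists>\<alpha>\<in>symmetrized_polydisc (n - 1).
      \<forall>i\<in>{1..n-1}. s i = \<alpha> i + cnj (\<alpha> (n - i)) * s n)"
  then obtain \<alpha> where lt: "cmod (s n) < 1" and mem: "\<alpha> \<in> symmetrized_polydisc (n - 1)"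
    and eq: "\<And>i. i \<in> {1..n-1} \<Longrightarrow> s i = \<alpha> i + cnj (\<alpha> (n - i)) * s n" by blast
  have \<alpha>: "\<alpha> \<in> {1..n-1} \<rightarrow>\<^sub>E UNIV" using mem by (auto simp: symmetrized_polydisc_def)
  define Q where "Q = vieta_poly (n - 1) \<alpha>"
  have nz: "\<forall>z\<in>cball 0 1. poly Q z \<noteq> 0"
    using mem symmetrized_polydisc_iff_no_zeros[OF \<alpha>] by (simp add: Q_def)
  have P: "vieta_poly n s = Q + smult ((-1) ^ n * s n) (pCons 0 (conj_reciprocal (n - 1) Q))"
  proof (rule poly_eqI)
    fix i
    consider "i = 0" | "i \<in> {1..n-1}" | "i = n" "i \<noteq> 0" | "n < i" using n by fastforce
    then show "coeff (vieta_poly n s) i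
        = coeff (Q + smult ((-1) ^ n * s n) (pCons 0 (conj_reciprocal (n - 1) Q))) i"
    proof cases
      case 2
      then obtain k where k: "i = Suc k" by (cases i) auto
      have "n - Suc 0 - k = n - i" using k by simp
      then have "coeff (Q + smult ((-1) ^ n * s n) (pCons 0 (conj_reciprocal (n - 1) Q))) i
          = (-1) ^ i * \<alpha> i + ((-1) ^ n * (-1) ^ (n - i)) * (s n * cnj (\<alpha> (n - i)))"
        using 2 k by (auto simp: Q_def coeff_vieta_poly coeff_conj_reciprocal)
      also have "\<dots> = (-1) ^ i * s i"
        using 2 by (subst minus_one_power_mult_diff) (auto simp: eq algebra_simps)
      finally show ?thesis using 2 by (auto simp: coeff_vieta_poly)
    qed (use n in \<open>auto simp: Q_def coeff_vieta_poly coeff_conj_reciprocal coeff_pCons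
        split: nat.splits\<close>)
  qed
  have "\<forall>z\<in>cball 0 1. poly (vieta_poly n s) z \<noteq> 0"
  proof
    fix z :: complex assume z: "z \<in> cball 0 1"
    have "cmod (s n) * cmod (z * poly (conj_reciprocal (n - 1) Q) z)
        \<le> cmod (s n) * (1 * cmod (poly Q z))"
      using cmod_conj_reciprocal_le[of Q "n - 1" z] nz z unfolding norm_mult
      by (intro mult_left_mono mult_mono) (auto simp: Q_def degree_vieta_poly)
    also have "\<dots> < cmod (poly Q z)" using lt nz z by simp
    finally have "poly Q z \<noteq> - ((-1) ^ n * s n * (z * poly (conj_reciprocal (n - 1) Q) z))"
      by (auto simp: norm_mult norm_power)
    then show "poly (vieta_poly n s) z \<noteq> 0" unfolding P by (simp add: eq_neg_iff_add_eq_0 mult_ac)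
  qed
  then show "s \<in> symmetrized_polydisc n"
    using symmetrized_polydisc_iff_no_zeros[OF s] by simp
qed

section \<open>The equivalences\<close>

theorem theorem3p1:
  fixes m p n :: nat and \<theta> :: "nat \<Rightarrow> complex"
  assumes "0 < m" and "0 < p" and "p dvd m" and "2 \<le> n"
    and "\<theta> \<in> {1..n} \<rightarrow>\<^sub>E UNIV"
  shows
    "(\<theta> \<in> Theta_domain m p n
        \<longleftrightarrow> \<theta>(n := \<theta> n ^ p) \<in> symmetrized_polydisc n)
   \<and> (\<theta>(n := \<theta> n ^ p) \<in> symmetrized_polydisc n
        \<longleftrightarrow> (SUP z\<in>cball 0 1. rat_fun_abs (f_rational p n \<theta>) z) < 1)
   \<and> ((SUP z\<in>cball 0 1. rat_fun_abs (f_rational p n \<theta>) z) < 1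
        \<longleftrightarrow> cmod (\<theta> n) < 1 \<and>
            (\<exists>\<alpha>\<in>symmetrized_polydisc (n - 1).
               \<forall>i\<in>{1..n-1}. \<theta> i = \<alpha> i + cnj (\<alpha> (n - i)) * \<theta> n ^ p))"
proof -
  let ?s = "\<theta>(n := \<theta> n ^ p)"
  have n: "1 \<le> n" using \<open>2 \<le> n\<close> by simp
  have s: "?s \<in> {1..n} \<rightarrow>\<^sub>E UNIV" using assms(5) n by (auto simp: PiE_def extensional_def)
  have 23: "?s \<in> symmetrized_polydisc n
      \<longleftrightarrow> (SUP z\<in>cball 0 1. rat_fun_abs (f_rational p n \<theta>) z) < 1"
    unfolding symmetrized_polydisc_iff_no_zeros[OF s] f_rational_def f_numerator_eq[OF n]
      f_denominator_eq[OF n, of \<theta> "\<theta> n ^ p"]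
    by (rule no_zeros_iff_sup_less_1[OF n degree_vieta_poly poly_vieta_poly_0])
  have "cmod (?s n) < 1 \<longleftrightarrow> cmod (\<theta> n) < 1"
    using \<open>0 < p\<close> by (simp add: norm_power power_less_one_iff)
  moreover have "?s i = \<theta> i" if "i \<in> {1..n-1}" for i using that by auto
  ultimately have 24: "?s \<in> symmetrized_polydisc n \<longleftrightarrow> cmod (\<theta> n) < 1 \<and>
      (\<exists>\<alpha>\<in>symmetrized_polydisc (n - 1).
         \<forall>i\<in>{1..n-1}. \<theta> i = \<alpha> i + cnj (\<alpha> (n - i)) * \<theta> n ^ p)"
    unfolding symmetrized_polydisc_reduction[OF n s] by simp
  show ?thesis
    using Theta_domain_iff[OF assms(1-3) n assms(5)] 23 24 by blast
qed

end
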